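(* Let $G$ be a nice bipartite graph. Then for every integer $t\geq 3$, $G$ admits an improper twin $t$-edge coloring.
   Context: A graph is nice if it has no connected component isomorphic to $K_2$ (a component with exactly two vertices). For an integer $k\geq 2$, an improper twin $k$-edge coloring of $G$ is a map $s:E(G)\to\mathbb{Z}_k$ (adjacent edges may receive equal colors) such that the map $c_s:V(G)\to\mathbb{Z}_k$, $c_s(v)=\sum_{e\in E_v}s(e)$ computed in $\mathbb{Z}_k$ (with $E_v$ the set of edges incident to $v$, and the empty sum equal to $0$), is a proper vertex coloring of $G$ (adjacent vertices get different values). *)

theory Defs
  imports "HOL-Number_Theory.Residues"
begin

locale finite_simple_graph =
  fixes V :: "'a set" and E :: "'a set set"
  assumes finite_V: "finite V"
    and edges: "e \<in> E \<Longrightarrow> e \<subseteq> V \<and> card e = 2"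

definition bipartite :: "'a set \<Rightarrow> 'a set set \<Rightarrow> bool" where
  "bipartite V E \<longleftrightarrow>
    (\<exists>A B. A \<union> B = V \<and> A \<inter> B = {} \<and> (\<forall>e\<in>E. \<exists>a\<in>A. \<exists>b\<in>B. e = {a, b}))"

definition adj_rel :: "'a set set \<Rightarrow> ('a \<times> 'a) set" where
  "adj_rel E = {(u, v). {u, v} \<in> E \<and> u \<noteq> v}"

definition component_of :: "'a set set \<Rightarrow> 'a \<Rightarrow> 'a set" where
  "component_of E v = {w. (v, w) \<in> (adj_rel E)\<^sup>*}"

definition induced_edges :: "'a set set \<Rightarrow> 'a set \<Rightarrow> 'a set set" where
  "induced_edges E C = {e \<in> E. e \<subseteq> C}"

text \<open>Connected components as subgraphs, i.e. pairs of a vertex set and an edge set.\<close>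

definition components :: "'a set \<Rightarrow> 'a set set \<Rightarrow> ('a set \<times> 'a set set) set" where
  "components V E = (\<lambda>v. (component_of E v, induced_edges E (component_of E v))) ` V"

definition graph_iso :: "'a set \<times> 'a set set \<Rightarrow> 'b set \<times> 'b set set \<Rightarrow> bool" where
  "graph_iso G H \<longleftrightarrow>
    (\<exists>f. bij_betw f (fst G) (fst H) \<and>
      (\<forall>u\<in>fst G. \<forall>v\<in>fst G. {u, v} \<in> snd G \<longleftrightarrow> {f u, f v} \<in> snd H))"

definition K2 :: "nat set \<times> nat set set" where
  "K2 = ({0, 1}, {{0, 1}})"

definition nice :: "'a set \<Rightarrow> 'a set set \<Rightarrow> bool" where
  "nice V E \<longleftrightarrow> \<not> (\<exists>C \<in> components V E. graph_iso C K2)"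

text \<open>
  The ring of integers modulo \<open>k\<close> is \<open>residue_ring (int k)\<close>, with carrier \<open>{0..k - 1}\<close>
  and addition modulo \<open>k\<close>; the definitions below are meant for \<open>k \<ge> 2\<close>.
\<close>

definition induced_coloring :: "nat \<Rightarrow> 'a set set \<Rightarrow> ('a set \<Rightarrow> int) \<Rightarrow> 'a \<Rightarrow> int" where
  "induced_coloring k E s v = finsum (residue_ring (int k)) s {e \<in> E. v \<in> e}"

definition proper_coloring :: "'a set set \<Rightarrow> ('a \<Rightarrow> 'c) \<Rightarrow> bool" where
  "proper_coloring E c \<longleftrightarrow> (\<forall>(u, v) \<in> adj_rel E. c u \<noteq> c v)"

definition improper_twin_edge_coloring ::
    "nat \<Rightarrow> 'a set set \<Rightarrow> ('a set \<Rightarrow> int) \<Rightarrow> bool" where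
  "improper_twin_edge_coloring k E s \<longleftrightarrow>
    s \<in> E \<rightarrow> carrier (residue_ring (int k)) \<and> proper_coloring E (induced_coloring k E s)"

text \<open>Sanity check: the components isomorphic to \<open>K2\<close> are those with exactly two vertices.\<close>

lemma (in finite_simple_graph) nice_iff_no_two_vertex_component:
  "nice V E \<longleftrightarrow> (\<forall>(C, F) \<in> components V E. card C \<noteq> 2)"
proof -
  have "graph_iso (component_of E v, induced_edges E (component_of E v)) K2
      \<longleftrightarrow> card (component_of E v) = 2" for v
  proof
    assume "graph_iso (component_of E v, induced_edges E (component_of E v)) K2"
    then obtain f where "bij_betw f (component_of E v) {0, 1 :: nat}"
      by (auto simp: graph_iso_def K2_def)
    then show "card (component_of E v) = 2"
      using bij_betw_same_card by fastforce
  next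
    assume card: "card (component_of E v) = 2"
    have "v \<in> component_of E v" by (simp add: component_of_def)
    with card obtain w where w: "w \<noteq> v" and C: "component_of E v = {v, w}"
      by (metis card_2_iff insertE insert_commute singletonD)
    have "(v, w) \<in> (adj_rel E)\<^sup>*" using C by (auto simp: component_of_def)
    then obtain u where u: "(v, u) \<in> adj_rel E"
      using w by (metis converse_rtranclE)
    then have "u \<in> {v, w}" using C by (auto simp: component_of_def)
    with u have vw: "{v, w} \<in> E" by (auto simp: adj_rel_def)
    have single: "{x} \<notin> E" for x using edges[of "{x}"] by auto
    define f where "f = (\<lambda>x. if x = v then 0 else 1 :: nat)"
    have "bij_betw f {v, w} {0, 1}" using w by (auto simp: f_def bij_betw_def)
    moreover have "\<forall>x\<in>{v, w}. \<forall>y\<in>{v, w}.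
        {x, y} \<in> induced_edges E {v, w} \<longleftrightarrow> {f x, f y} \<in> {{0, 1}}"
      using w vw single
      by (auto simp: f_def induced_edges_def insert_commute doubleton_eq_iff)
    ultimately show "graph_iso (component_of E v, induced_edges E (component_of E v)) K2"
      unfolding graph_iso_def K2_def C fst_conv snd_conv by blast
  qed
  then show ?thesis by (auto simp: nice_def components_def)
qed

end

theory Submission
  imports Defs
begin

text \<open>
  Alternating the weights \<open>\<plusminus>1\<close> along a walk between two vertices \<open>u\<close>, \<open>w\<close> of the same side
  yields an integer edge weighting whose vertex sums are \<open>1\<close> at \<open>u\<close>, \<open>-1\<close> at \<open>w\<close> and \<open>0\<close>
  elsewhere. A component on at least three vertices has a side \<open>S\<close> with at least two vertices;
  fixing \<open>a\<close> in \<open>S\<close> and combining the walks from the other vertices of \<open>S\<close> to \<open>a\<close> with suitable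
  signs makes the sums \<open>\<plusminus>1\<close> on \<open>S - {a}\<close>, \<open>-1\<close> or \<open>-2\<close> at \<open>a\<close>, and \<open>0\<close> outside \<open>S\<close>. None of
  \<open>1\<close>, \<open>-1\<close>, \<open>-2\<close> vanishes modulo \<open>t \<ge> 3\<close>.
\<close>

definition vertex_sum :: "'a set set \<Rightarrow> ('a set \<Rightarrow> int) \<Rightarrow> 'a \<Rightarrow> int" where
  "vertex_sum E s v = (\<Sum>e | e \<in> E \<and> v \<in> e. s e)"

lemma (in finite_simple_graph) finite_E: "finite E"
  using finite_V edges by (meson Pow_iff finite_Pow_iff finite_subset subsetI)

lemma (in finite_simple_graph) vertex_sum_single_edge:
  assumes "e \<in> E"
  shows "vertex_sum E (\<lambda>e'. if e' = e then c else 0) v = (if v \<in> e then c else 0)"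
proof -
  have "finite {e \<in> E. v \<in> e}" using finite_E by simp
  then show ?thesis using assms by (simp add: vertex_sum_def sum.delta)
qed

text \<open>Induction along the walk: giving the new edge \<open>{y, z}\<close> the extra weight
  \<open>\<sigma> u * \<sigma> y\<close> cancels the surplus at \<open>y\<close> and leaves
  \<open>- \<sigma> u * \<sigma> z\<close> at \<open>z\<close>, because the sign flips across the
  edge. Weights of repeated edges add up, so the walk need not be a path.\<close>

lemma (in finite_simple_graph) alternating_walk:
  fixes \<sigma> :: "'a \<Rightarrow> int"
  assumes sign: "\<And>x. \<sigma> x * \<sigma> x = 1"
    and flip: "\<And>x y. (x, y) \<in> adj_rel E \<Longrightarrow> \<sigma> y = - \<sigma> x"
    and "(u, w) \<in> (adj_rel E)\<^sup>*"
  shows "\<exists>s. \<forall>v. vertex_sum E s v = of_bool (v = u) - \<sigma> u * \<sigma> w * of_bool (v = w)"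
  using assms(3)
proof (induction rule: rtrancl_induct)
  case base
  show ?case by (rule exI[of _ "\<lambda>_. 0"]) (simp add: vertex_sum_def sign)
next
  case (step y z)
  then obtain s where s: "\<And>v. vertex_sum E s v = of_bool (v = u) - \<sigma> u * \<sigma> y * of_bool (v = y)"
    by blast
  have yz: "{y, z} \<in> E" "y \<noteq> z" using step by (auto simp: adj_rel_def)
  let ?d = "\<lambda>e. if e = {y, z} then \<sigma> u * \<sigma> y else 0"
  have "vertex_sum E (\<lambda>e. s e + ?d e) v = of_bool (v = u) - \<sigma> u * \<sigma> z * of_bool (v = z)" for v
  proof -
    have "vertex_sum E (\<lambda>e. s e + ?d e) v = vertex_sum E s v + vertex_sum E ?d v"
      by (simp add: vertex_sum_def sum.distrib)
    then show ?thesis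
      using s[of v] yz flip[OF step(2)] vertex_sum_single_edge[OF yz(1), of "\<sigma> u * \<sigma> y" v]
      by auto
  qed
  then show ?case by blast
qed

text \<open>Greedy choice: a new element gets sign 1 when the running sum is 1 and sign -1 when it
  is 2. Keeping the sum small and nonzero keeps the total at the base vertex nonzero modulo every
  \<open>t \<ge> 3\<close>.\<close>

lemma signs_with_sum_1_or_2:
  assumes "finite T" "T \<noteq> {}"
  shows "\<exists>x :: 'a \<Rightarrow> int. (\<forall>a\<in>T. x a \<in> {1, -1}) \<and> sum x T \<in> {1, 2}"
  using assms
proof (induction rule: finite_ne_induct)
  case (singleton b)
  show ?case by (rule exI[of _ "\<lambda>_. 1"]) simp
next
  case (insert b T)
  then obtain x :: "'a \<Rightarrow> int" where x: "\<forall>a\<in>T. x a \<in> {1, -1}" "sum x T \<in> {1, 2}"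
    by blast
  define y where "y = x(b := if sum x T = 1 then 1 else -1)"
  have "sum y T = sum x T"
    unfolding y_def using insert.hyps by (intro sum.cong) auto
  then have "sum y (insert b T) = y b + sum x T"
    using insert.hyps by simp
  then have "sum y (insert b T) \<in> {1, 2}" "\<forall>a\<in>insert b T. y a \<in> {1, -1}"
    using x by (auto simp: y_def)
  then show ?case by blast
qed

lemma (in finite_simple_graph) one_side_weighting:
  assumes disj: "A \<inter> B = {}"
    and cross: "\<And>e. e \<in> E \<Longrightarrow> \<exists>a\<in>A. \<exists>b\<in>B. e = {a, b}"
    and card: "card (component_of E r \<inter> A) \<ge> 2"
  shows "\<exists>s. \<forall>v. if v \<in> component_of E r \<inter> A then vertex_sum E s v \<in> {1, -1, -2}
    else vertex_sum E s v = 0"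
proof -
  define S where "S = component_of E r \<inter> A"
  have card_S: "card S \<ge> 2" using card by (simp add: S_def)
  then have "card S > 0" by linarith
  then have fin: "finite S" and "S \<noteq> {}" using card_gt_0_iff by blast+
  then obtain a where a: "a \<in> S" by blast
  define T where "T = S - {a}"
  \<comment> \<open>The second vertex of \<open>S\<close> matters here: with \<open>T\<close> empty,
    the sum at \<open>a\<close> would be 0.\<close>
  have "card T \<ge> 1" using card_S a fin by (simp add: T_def)
  then have "T \<noteq> {}" by auto
  moreover have finT: "finite T" using fin by (simp add: T_def)
  ultimately obtain x :: "'a \<Rightarrow> int" where x: "\<forall>b\<in>T. x b \<in> {1, -1}" "sum x T \<in> {1, 2}"
    using signs_with_sum_1_or_2[of T] by auto
  define \<sigma> :: "'a \<Rightarrow> int" where "\<sigma> v = (if v \<in> A then 1 else -1)" for v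
  have sign: "\<sigma> v * \<sigma> v = 1" for v by (simp add: \<sigma>_def)
  have flip: "\<sigma> z = - \<sigma> y" if "(y, z) \<in> adj_rel E" for y z
  proof -
    have "{y, z} \<in> E" using that by (simp add: adj_rel_def)
    then obtain a b where "a \<in> A" "b \<in> B" "{y, z} = {a, b}" using cross by blast
    then show ?thesis using disj by (auto simp: \<sigma>_def doubleton_eq_iff)
  qed
  have "sym (adj_rel E)" by (auto simp: sym_def adj_rel_def insert_commute)
  then have sym: "sym ((adj_rel E)\<^sup>*)" by (rule sym_rtrancl)
  \<comment> \<open>Both ends lie in \<open>A\<close>, so \<open>\<sigma> b * \<sigma> a = 1\<close>
    and the walk leaves 1 at \<open>b\<close> and -1 at \<open>a\<close>.\<close>
  have "\<exists>s. \<forall>v. vertex_sum E s v = of_bool (v = b) - of_bool (v = a)" if "b \<in> T" for b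
  proof -
    have "(r, b) \<in> (adj_rel E)\<^sup>*" "(r, a) \<in> (adj_rel E)\<^sup>*" and A: "a \<in> A" "b \<in> A"
      using a that by (auto simp: S_def T_def component_of_def)
    then have "(b, a) \<in> (adj_rel E)\<^sup>*" using sym by (meson rtrancl_trans symD)
    from alternating_walk[of \<sigma>, OF sign flip this] show ?thesis using A by (simp add: \<sigma>_def)
  qed
  then obtain s where
    s: "\<And>b v. b \<in> T \<Longrightarrow> vertex_sum E (s b) v = of_bool (v = b) - of_bool (v = a)"
    by metis
  \<comment> \<open>Vertex sums are linear in the weights: each \<open>b\<close> in \<open>T\<close>
    keeps its own sign, and all the negative ends accumulate at \<open>a\<close>.\<close>
  have sum: "vertex_sum E (\<lambda>e. \<Sum>b\<in>T. x b * s b e) v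
      = (if v \<in> T then x v else 0) - of_bool (v = a) * sum x T" for v
  proof -
    have "vertex_sum E (\<lambda>e. \<Sum>b\<in>T. x b * s b e) v = (\<Sum>b\<in>T. x b * vertex_sum E (s b) v)"
      unfolding vertex_sum_def sum_distrib_left by (rule sum.swap)
    also have "\<dots> = (\<Sum>b\<in>T. (if b = v then x b else 0) - of_bool (v = a) * x b)"
      using s by (intro sum.cong) auto
    also have "\<dots> = (if v \<in> T then x v else 0) - of_bool (v = a) * sum x T"
      using finT by (simp add: sum_subtractf sum_distrib_left sum.delta)
    finally show ?thesis .
  qed
  have "if v \<in> S then vertex_sum E (\<lambda>e. \<Sum>b\<in>T. x b * s b e) v \<in> {1, -1, -2}
      else vertex_sum E (\<lambda>e. \<Sum>b\<in>T. x b * s b e) v = 0" for v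
    unfolding sum using x a by (auto simp: T_def)
  then show ?thesis unfolding S_def by blast
qed

text \<open>Each edge of the component has exactly one end on the chosen side, where the sum is
  nonzero modulo \<open>t\<close>; at the other end it is 0. A vertex \<open>r\<close> outside
  \<open>V\<close> is harmless, since its component has no edges.\<close>

lemma (in finite_simple_graph) component_weighting:
  assumes bip: "bipartite V E" and nice: "nice V E" and t: "t \<ge> 3"
  shows "\<exists>s. \<forall>u\<in>component_of E r. \<forall>w. (u, w) \<in> adj_rel E \<longrightarrow>
    vertex_sum E s u mod int t \<noteq> vertex_sum E s w mod int t"
proof (cases "\<exists>u\<in>component_of E r. \<exists>w. (u, w) \<in> adj_rel E")
  case True
  define C where "C = component_of E r"
  obtain A B where AB: "A \<union> B = V" "A \<inter> B = {}"
    and cross: "\<And>e. e \<in> E \<Longrightarrow> \<exists>a\<in>A. \<exists>b\<in>B. e = {a, b}"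
    using bip by (auto simp: bipartite_def)
  have C_step: "w \<in> C" if "u \<in> C" "(u, w) \<in> adj_rel E" for u w
    using that by (auto simp: C_def component_of_def)
  have adj_V: "u \<in> V \<and> w \<in> V" if "(u, w) \<in> adj_rel E" for u w
    using that edges by (auto simp: adj_rel_def)
  obtain u w where uw: "u \<in> C" "(u, w) \<in> adj_rel E" using True by (auto simp: C_def)
  \<comment> \<open>Either \<open>r = u\<close>, or the walk from \<open>r\<close> to
    \<open>u\<close> starts with an edge at \<open>r\<close>.\<close>
  have rV: "r \<in> V"
    using uw adj_V unfolding C_def component_of_def by (metis converse_rtranclE mem_Collect_eq)
  have "C \<subseteq> V"
  proof
    fix v assume "v \<in> C"
    then have "(r, v) \<in> (adj_rel E)\<^sup>*" by (simp add: C_def component_of_def)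
    then show "v \<in> V" using rV adj_V by (induction rule: rtrancl_induct) auto
  qed
  then have finC: "finite C" using finite_V by (rule finite_subset)
  have "card C \<noteq> 2"
    using nice rV by (auto simp: nice_iff_no_two_vertex_component components_def C_def)
  moreover have "card {u, w} \<le> card C"
    using uw C_step finC by (intro card_mono) auto
  moreover have "u \<noteq> w" using uw by (simp add: adj_rel_def)
  ultimately have "card C \<ge> 3" by simp
  moreover have "card C = card (C \<inter> A) + card (C \<inter> B)"
  proof -
    have "C = C \<inter> A \<union> C \<inter> B" using AB \<open>C \<subseteq> V\<close> by blast
    moreover have "card (C \<inter> A \<union> C \<inter> B) = card (C \<inter> A) + card (C \<inter> B)"
      using AB finC by (intro card_Un_disjoint) auto
    ultimately show ?thesis by simp
  qed
  ultimately have "card (C \<inter> A) \<ge> 2 \<or> card (C \<inter> B) \<ge> 2" by linarith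
  \<comment> \<open>The sides are renamed so that \<open>A'\<close> is one with at least two
    vertices of the component.\<close>
  then obtain A' B' where AB': "A' \<inter> B' = {}"
    and cross': "\<And>e. e \<in> E \<Longrightarrow> \<exists>a\<in>A'. \<exists>b\<in>B'. e = {a, b}"
    and card': "card (C \<inter> A') \<ge> 2"
  proof
    assume "card (C \<inter> B) \<ge> 2"
    moreover have "\<exists>b\<in>B. \<exists>a\<in>A. e = {b, a}" if "e \<in> E" for e
      using cross[OF that] by (metis insert_commute)
    ultimately show ?thesis using AB that[of B A] by auto
  qed (use AB cross that[of A B] in auto)
  obtain s where s: "\<And>v. if v \<in> C \<inter> A' then vertex_sum E s v \<in> {1, -1, -2}
      else vertex_sum E s v = 0"
    using one_side_weighting[OF AB' cross' card'[unfolded C_def]] by (auto simp: C_def)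
  have nonzero: "k mod int t \<noteq> 0" if "k \<in> {1, -1, -2}" for k :: int
  proof
    assume "k mod int t = 0"
    then have "int t dvd k" by (rule dvd_eq_mod_eq_0[THEN iffD2])
    \<comment> \<open>A nonzero multiple of \<open>t\<close> has absolute value at least 3, while
      \<open>k\<close> has at most 2.\<close>
    then have "\<bar>int t\<bar> \<le> \<bar>k\<bar>" using that by (intro dvd_imp_le_int) auto
    then show False using that t by auto
  qed
  have "vertex_sum E s u mod int t \<noteq> vertex_sum E s w mod int t"
    if "u \<in> C" "(u, w) \<in> adj_rel E" for u w
  proof -
    have "{u, w} \<in> E" using that by (simp add: adj_rel_def)
    then obtain a b where "a \<in> A'" "b \<in> B'" "{u, w} = {a, b}" using cross' by blast
    then have "u \<in> A' \<and> w \<notin> A' \<or> w \<in> A' \<and> u \<notin> A'"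
      using AB' by (auto simp: doubleton_eq_iff)
    then show ?thesis
      using s[of u] s[of w] nonzero[of "vertex_sum E s u"] nonzero[of "vertex_sum E s w"]
        that C_step[OF that]
      by (auto split: if_splits)
  qed
  then show ?thesis by (auto simp: C_def)
qed blast

text \<open>Reduction modulo \<open>k\<close> commutes with finite sums, so integer weights suffice
  until the very end.\<close>

lemma induced_coloring_mod:
  assumes "finite E" "k \<ge> 2"
  shows "induced_coloring k E (\<lambda>e. s e mod int k) v = vertex_sum E s v mod int k"
proof -
  interpret residues "int k" "residue_ring (int k)"
    using assms(2) by unfold_locales auto
  have "finsum (residue_ring (int k)) (\<lambda>e. s e mod int k) F = sum s F mod int k"
    if "finite F" for F
    using that
  proof (induction rule: finite_induct)
    case empty
    show ?case by (simp add: res_zero_eq)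
  next
    case (insert e F)
    have "(\<lambda>e. s e mod int k) \<in> F \<rightarrow> carrier (residue_ring (int k))" by auto
    with insert show ?case by (simp add: res_add_eq mod_simps)
  qed
  then show ?thesis using assms(1) by (simp add: induced_coloring_def vertex_sum_def)
qed

theorem theorem2:
  fixes V :: "'a set" and E :: "'a set set"
  assumes "finite_simple_graph V E"
    and "bipartite V E"
    and "nice V E"
  shows "\<forall>t::nat. t \<ge> 3 \<longrightarrow> (\<exists>s. improper_twin_edge_coloring t E s)"
proof (intro allI impI)
  fix t :: nat assume t: "t \<ge> 3"
  interpret finite_simple_graph V E by fact
  have "\<exists>s. \<forall>u\<in>component_of E r. \<forall>w. (u, w) \<in> adj_rel E \<longrightarrow>
      vertex_sum E s u mod int t \<noteq> vertex_sum E s w mod int t" for r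
    using component_weighting[OF assms(2,3) t] .
  \<comment> \<open>Indexing by the component \<open>C\<close> instead of a representative makes the
    choice of \<open>s\<close> the same for all vertices of one component.\<close>
  then have "\<exists>s. \<forall>u\<in>C. \<forall>w. (u, w) \<in> adj_rel E \<longrightarrow>
      vertex_sum E s u mod int t \<noteq> vertex_sum E s w mod int t" if "C \<in> range (component_of E)" for C
    using that by auto
  then obtain s where s: "\<And>C u w. C \<in> range (component_of E) \<Longrightarrow> u \<in> C \<Longrightarrow> (u, w) \<in> adj_rel E \<Longrightarrow>
      vertex_sum E (s C) u mod int t \<noteq> vertex_sum E (s C) w mod int t"
    by metis
  \<comment> \<open>Gluing: each edge takes its weight from its own component. Both ends lie in that
    component, so the end picked by \<open>SOME\<close> does not matter.\<close>
  define g where "g e = s (component_of E (SOME v. v \<in> e)) e" for e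
  have sym: "sym ((adj_rel E)\<^sup>*)"
    by (intro sym_rtrancl) (auto simp: sym_def adj_rel_def insert_commute)
  have comp_eq: "component_of E x = component_of E y" if "(x, y) \<in> (adj_rel E)\<^sup>*" for x y
  proof -
    have "(y, x) \<in> (adj_rel E)\<^sup>*" using that sym by (rule symD[rotated])
    then show ?thesis using that by (auto simp: component_of_def intro: rtrancl_trans)
  qed
  have g_sum: "vertex_sum E g v = vertex_sum E (s (component_of E v)) v" for v
    unfolding vertex_sum_def
  proof (rule sum.cong[OF refl])
    fix e assume "e \<in> {e \<in> E. v \<in> e}"
    then have e: "e \<in> E" "v \<in> e" by auto
    define x where "x = (SOME v. v \<in> e)"
    have x: "x \<in> e" unfolding x_def using e(2) by (rule someI)
    have "(x, v) \<in> (adj_rel E)\<^sup>*"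
    proof (cases "x = v")
      case False
      with x e have "{x, v} = e"
        using edges[OF e(1)] by (metis card_2_iff doubleton_eq_iff insert_iff singletonD)
      with False e show ?thesis by (auto simp: adj_rel_def)
    qed simp
    then show "g e = s (component_of E v) e"
      using comp_eq by (simp add: g_def flip: x_def)
  qed
  have "vertex_sum E g u mod int t \<noteq> vertex_sum E g w mod int t" if "(u, w) \<in> adj_rel E" for u w
  proof -
    have "component_of E u = component_of E w" using that comp_eq by blast
    moreover have "u \<in> component_of E u" by (simp add: component_of_def)
    ultimately show ?thesis using s[OF _ _ that] g_sum by (metis rangeI)
  qed
  moreover have "induced_coloring t E (\<lambda>e. g e mod int t) v = vertex_sum E g v mod int t" for v
    using t by (intro induced_coloring_mod finite_E) simp
  moreover have "(\<lambda>e. g e mod int t) \<in> E \<rightarrow> carrier (residue_ring (int t))"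
    using t by (auto simp: residue_ring_def zle_diff1_eq)
  ultimately have "improper_twin_edge_coloring t E (\<lambda>e. g e mod int t)"
    by (auto simp: improper_twin_edge_coloring_def proper_coloring_def)
  then show "\<exists>s. improper_twin_edge_coloring t E s" by blast
qed

end
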